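(* Let $A$ be a locally Frobenius $k$-algebra of shape $\Lambda$ and let $S$ be a simple $A$-module. Then $S$ is isomorphic to a submodule of $A$ if and only if $S$ is coherent.
   Context: $k$ is a field; all rings, algebras, modules and homomorphisms are unital. "$A$-module" means left $A$-module throughout, or right $A$-module throughout. Frobenius notions: a finite dimensional $k$-algebra $R$ is Frobenius if there is a linear form $\theta\colon R\to k$ (a Frobenius form) such that the bilinear form $(x,y)\mapsto\theta(xy)$ is nondegenerate; it is symmetric if $\theta$ can be chosen so that this bilinear form is symmetric. For a homomorphism of $k$-algebras $B\to C$, the extension $C:B$ is a Frobenius extension if there are a $B$-bimodule homomorphism $\Phi\colon C\to B$ and elements $x_i,y_i\in C$ ($1\le i\le n$) with $\sum_i y_i\Phi(x_ic)=c=\sum_i\Phi(cy_i)x_i$ for all $c\in C$; it is a free Frobenius extension if moreover $C$ is free as a left and as a right $B$-module. Shape: $(\Lambda,\preccurlyeq,\lambda_0)$ is an infinite partially ordered set such that any two elements have a common upper bound, $\lambda_0$ is a unique initial element, and for every $\lambda\in\Lambda$ there is $\lambda'\in\Lambda$ with $\lambda\preccurlyeq\lambda'$, $\lambda\ne\lambda'$. A (necessarily infinite dimensional) $k$-algebra $A$ is locally Frobenius of shape $\Lambda$ if: (a) there is a $\Lambda$-directed system of symmetric Frobenius $k$-algebras $A(\lambda)$ ($\lambda\in\Lambda$), augmented over $k$, with proper inclusion homomorphisms (of augmented algebras) $A(\lambda')\hookrightarrow A(\lambda'')$ for $\lambda'\preccurlyeq\lambda''$, $\lambda'\neq\lambda''$,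 with $A(\lambda_0)=k$ and $A=\bigcup_{\lambda\in\Lambda}A(\lambda)$; (b) each inclusion makes $A(\lambda''):A(\lambda')$ a free Frobenius extension. A module is pseudo-coherent if every finitely generated submodule is finitely presented, and coherent if it is finitely generated and pseudo-coherent. *)

theory Defs
  imports Complex_Main "HOL-Library.Function_Algebras"
begin

text \<open>Algebras over a field are unital and not assumed commutative; the ambient algebra is the
  whole type \<open>'a\<close>, and its subalgebras are subsets.\<close>

datatype side = Left | Right

text \<open>The action of a ring on itself: \<open>regular Left a x = a x\<close>, \<open>regular Right a x = x a\<close>.\<close>

fun regular :: "side \<Rightarrow> 'a::times \<Rightarrow> 'a \<Rightarrow> 'a" where
  "regular Left a x = a * x"
| "regular Right a x = x * a"


subsection \<open>Frobenius extensions\<close>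

definition bimodule_hom_on :: "'a::ring_1 set \<Rightarrow> 'a set \<Rightarrow> ('a \<Rightarrow> 'a) \<Rightarrow> bool" where
  "bimodule_hom_on B C \<Phi> \<longleftrightarrow>
     (\<forall>c\<in>C. \<Phi> c \<in> B) \<and>
     (\<forall>c\<in>C. \<forall>d\<in>C. \<Phi> (c + d) = \<Phi> c + \<Phi> d) \<and>
     (\<forall>b\<in>B. \<forall>c\<in>C. \<Phi> (b * c) = b * \<Phi> c \<and> \<Phi> (c * b) = \<Phi> c * b)"

text \<open>Here and below the extension \<open>C : B\<close> is that of the inclusion of subalgebras \<open>B \<subseteq> C\<close>.\<close>

definition frobenius_extension :: "'a::ring_1 set \<Rightarrow> 'a set \<Rightarrow> bool" where
  "frobenius_extension B C \<longleftrightarrow>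
     (\<exists>\<Phi> (n::nat) x y. bimodule_hom_on B C \<Phi> \<and> (\<forall>i<n. x i \<in> C \<and> y i \<in> C) \<and>
        (\<forall>c\<in>C. (\<Sum>i<n. y i * \<Phi> (x i * c)) = c \<and> (\<Sum>i<n. \<Phi> (c * y i) * x i) = c))"

text \<open>\<open>C\<close> is free as a left (right) \<open>B\<close>-module: there is a basis \<open>X\<close>, not required to be finite,
  over which every element of \<open>C\<close> has unique coordinates \<open>f\<close> in \<open>B\<close>.\<close>

definition free_over :: "side \<Rightarrow> 'a::ring_1 set \<Rightarrow> 'a set \<Rightarrow> bool" where
  "free_over s B C \<longleftrightarrow>
     (\<exists>X\<subseteq>C. \<forall>c\<in>C. \<exists>!f. range f \<subseteq> B \<and> finite {x. f x \<noteq> 0} \<and> {x. f x \<noteq> 0} \<subseteq> X \<and>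
        c = (\<Sum>x | f x \<noteq> 0. regular s (f x) x))"

definition free_frobenius_extension :: "'a::ring_1 set \<Rightarrow> 'a set \<Rightarrow> bool" where
  "free_frobenius_extension B C \<longleftrightarrow>
     frobenius_extension B C \<and> free_over Left B C \<and> free_over Right B C"


subsection \<open>Locally Frobenius algebras\<close>

definition shape :: "'l::order \<Rightarrow> bool" where
  "shape l0 \<longleftrightarrow>
     infinite (UNIV :: 'l set) \<and>
     (\<forall>l m :: 'l. \<exists>u. l \<le> u \<and> m \<le> u) \<and>
     (\<forall>l. l0 \<le> l) \<and>
     (\<forall>l :: 'l. \<exists>m. l < m)"

locale k_algebra = vector_space scale
  for scale :: "'k::field \<Rightarrow> 'a::ring_1 \<Rightarrow> 'a" (infixr \<open>*k\<close> 75) +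
  assumes scale_mult_left: "(c *k x) * y = c *k (x * y)"
    and scale_mult_right: "x * (c *k y) = c *k (x * y)"
begin

definition subalgebra :: "'a set \<Rightarrow> bool" where
  "subalgebra R \<longleftrightarrow> subspace R \<and> 1 \<in> R \<and> (\<forall>x\<in>R. \<forall>y\<in>R. x * y \<in> R)"

definition linear_form_on :: "'a set \<Rightarrow> ('a \<Rightarrow> 'k) \<Rightarrow> bool" where
  "linear_form_on R \<theta> \<longleftrightarrow>
     (\<forall>x\<in>R. \<forall>y\<in>R. \<theta> (x + y) = \<theta> x + \<theta> y) \<and> (\<forall>c. \<forall>x\<in>R. \<theta> (c *k x) = c * \<theta> x)"

definition frobenius_form :: "'a set \<Rightarrow> ('a \<Rightarrow> 'k) \<Rightarrow> bool" where
  "frobenius_form R \<theta> \<longleftrightarrow>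
     linear_form_on R \<theta> \<and>
     (\<forall>x\<in>R. (\<forall>y\<in>R. \<theta> (x * y) = 0) \<longrightarrow> x = 0) \<and>
     (\<forall>y\<in>R. (\<forall>x\<in>R. \<theta> (x * y) = 0) \<longrightarrow> y = 0)"

definition symmetric_frobenius :: "'a set \<Rightarrow> bool" where
  "symmetric_frobenius R \<longleftrightarrow>
     subalgebra R \<and> (\<exists>F. finite F \<and> span F = R) \<and>
     (\<exists>\<theta>. frobenius_form R \<theta> \<and> (\<forall>x\<in>R. \<forall>y\<in>R. \<theta> (x * y) = \<theta> (y * x)))"

definition augmentation_on :: "'a set \<Rightarrow> ('a \<Rightarrow> 'k) \<Rightarrow> bool" where
  "augmentation_on R \<epsilon> \<longleftrightarrow>
     linear_form_on R \<epsilon> \<and> \<epsilon> 1 = 1 \<and> (\<forall>x\<in>R. \<forall>y\<in>R. \<epsilon> (x * y) = \<epsilon> x * \<epsilon> y)"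

text \<open>The directed system is realised by subalgebras \<open>A l\<close> of the ambient algebra, with the
  inclusions as structure maps; the base field is embedded as the multiples of \<open>1\<close>.\<close>

definition locally_frobenius :: "'l::order \<Rightarrow> bool" where
  "locally_frobenius l0 \<longleftrightarrow>
     (\<exists>(A :: 'l \<Rightarrow> 'a set) (\<epsilon> :: 'l \<Rightarrow> 'a \<Rightarrow> 'k).
        (\<forall>l. symmetric_frobenius (A l) \<and> augmentation_on (A l) (\<epsilon> l)) \<and>
        (\<forall>l m. l < m \<longrightarrow> A l \<subset> A m \<and> (\<forall>x\<in>A l. \<epsilon> m x = \<epsilon> l x)) \<and>
        A l0 = range (\<lambda>c. c *k 1) \<and>
        (\<Union>l. A l) = UNIV \<and>
        (\<forall>l m. l < m \<longrightarrow> free_frobenius_extension (A l) (A m)))"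

end


subsection \<open>Modules over a noncommutative ring\<close>

text \<open>\<open>act a x\<close> stands for \<open>a x\<close> in a left and for \<open>x a\<close> in a right module. Since
  \<open>regular Right a b = b * a\<close>, the last axiom then reads \<open>x (b a) = (x b) a\<close> in the right case.\<close>

locale ring_module =
  fixes s :: side and act :: "'a::ring_1 \<Rightarrow> 'm::ab_group_add \<Rightarrow> 'm"
  assumes act_add_right: "act a (x + y) = act a x + act a y"
    and act_add_left: "act (a + b) x = act a x + act b x"
    and act_one: "act 1 x = x"
    and act_act: "act (regular s a b) x = act a (act b x)"

definition submodule :: "('a::ring_1 \<Rightarrow> 'm::ab_group_add \<Rightarrow> 'm) \<Rightarrow> 'm set \<Rightarrow> bool" where
  "submodule act N \<longleftrightarrow>
     0 \<in> N \<and> (\<forall>x\<in>N. \<forall>y\<in>N. x + y \<in> N) \<and> (\<forall>a. \<forall>x\<in>N. act a x \<in> N)"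

definition hom_on :: "('a::ring_1 \<Rightarrow> 'm::ab_group_add \<Rightarrow> 'm) \<Rightarrow> 'm set \<Rightarrow>
    ('a \<Rightarrow> 'n::ab_group_add \<Rightarrow> 'n) \<Rightarrow> 'n set \<Rightarrow> ('m \<Rightarrow> 'n) \<Rightarrow> bool" where
  "hom_on act M act' N \<phi> \<longleftrightarrow>
     \<phi> ` M \<subseteq> N \<and>
     (\<forall>x\<in>M. \<forall>y\<in>M. \<phi> (x + y) = \<phi> x + \<phi> y) \<and> (\<forall>a. \<forall>x\<in>M. \<phi> (act a x) = act' a (\<phi> x))"

definition isomorphic :: "('a::ring_1 \<Rightarrow> 'm::ab_group_add \<Rightarrow> 'm) \<Rightarrow> 'm set \<Rightarrow>
    ('a \<Rightarrow> 'n::ab_group_add \<Rightarrow> 'n) \<Rightarrow> 'n set \<Rightarrow> bool" where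
  "isomorphic act M act' N \<longleftrightarrow> (\<exists>\<phi>. hom_on act M act' N \<phi> \<and> bij_betw \<phi> M N)"

definition simple_module :: "('a::ring_1 \<Rightarrow> 'm::ab_group_add \<Rightarrow> 'm) \<Rightarrow> bool" where
  "simple_module act \<longleftrightarrow>
     (UNIV :: 'm set) \<noteq> {0} \<and> (\<forall>N. submodule act N \<longrightarrow> N = {0} \<or> N = UNIV)"

definition finitely_generated :: "('a::ring_1 \<Rightarrow> 'm::ab_group_add \<Rightarrow> 'm) \<Rightarrow> 'm set \<Rightarrow> bool" where
  "finitely_generated act N \<longleftrightarrow> (\<exists>F. finite F \<and> submodule act hull F = N)"

text \<open>The free module of rank \<open>n\<close>, inside the module of all sequences.\<close>

definition seq_act :: "side \<Rightarrow> 'a::ring_1 \<Rightarrow> (nat \<Rightarrow> 'a) \<Rightarrow> nat \<Rightarrow> 'a" where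
  "seq_act s a v = (\<lambda>i. regular s a (v i))"

definition free_module :: "nat \<Rightarrow> (nat \<Rightarrow> 'a::ring_1) set" where
  "free_module n = {v. \<forall>i\<ge>n. v i = 0}"

definition finitely_presented ::
    "side \<Rightarrow> ('a::ring_1 \<Rightarrow> 'm::ab_group_add \<Rightarrow> 'm) \<Rightarrow> 'm set \<Rightarrow> bool" where
  "finitely_presented s act N \<longleftrightarrow>
     (\<exists>n \<phi>. hom_on (seq_act s) (free_module n) act N \<phi> \<and> \<phi> ` free_module n = N \<and>
        finitely_generated (seq_act s) {v \<in> free_module n. \<phi> v = 0})"

definition pseudo_coherent ::
    "side \<Rightarrow> ('a::ring_1 \<Rightarrow> 'm::ab_group_add \<Rightarrow> 'm) \<Rightarrow> 'm set \<Rightarrow> bool" where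
  "pseudo_coherent s act N \<longleftrightarrow>
     (\<forall>L\<subseteq>N. submodule act L \<and> finitely_generated act L \<longrightarrow> finitely_presented s act L)"

definition coherent :: "side \<Rightarrow> ('a::ring_1 \<Rightarrow> 'm::ab_group_add \<Rightarrow> 'm) \<Rightarrow> 'm set \<Rightarrow> bool" where
  "coherent s act N \<longleftrightarrow> finitely_generated act N \<and> pseudo_coherent s act N"

end

theory Submission
  imports Defs
begin

text \<open>A simple submodule of \<open>A\<close> is generated by some \<open>x \<in> A(\<lambda>)\<close>. As \<open>A\<close> is a union of
  algebras that are free over \<open>A(\<lambda>)\<close>, the annihilator of \<open>x\<close> in \<open>A\<close> is generated by the
  annihilator of \<open>x\<close> in \<open>A(\<lambda>)\<close>, which is finite dimensional; so the submodule is finitely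
  presented.

  Conversely, if \<open>S = A/L\<close> is finitely presented, then \<open>L\<close> is generated by finitely many elements
  of some \<open>A(\<lambda>)\<close>. As \<open>1 \<notin> L\<close>, nondegeneracy of the Frobenius form of \<open>A(\<lambda>)\<close> yields a
  nonzero \<open>r \<in> A(\<lambda>)\<close> that is orthogonal to the ideal \<open>L \<inter> A(\<lambda>)\<close> and hence annihilated by it.
  Then \<open>a + L \<mapsto> a r\<close> is a nonzero homomorphism \<open>S \<rightarrow> A\<close>, which is injective since \<open>S\<close> is
  simple.\<close>

subsection \<open>Modules\<close>

text \<open>These are the laws of a ring product: \<open>regular s\<close> is the multiplication of
  the ring or of its opposite, so one argument serves left and right modules alike.\<close>

lemma regular_simps:
  fixes a b c :: "'a::ring_1"
  shows "regular s a (b + c) = regular s a b + regular s a c"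
    and "regular s (a + b) c = regular s a c + regular s b c"
    and "regular s a (b - c) = regular s a b - regular s a c"
    and "regular s (a - b) c = regular s a c - regular s b c"
    and "regular s 1 a = a" and "regular s a 1 = a"
    and "regular s 0 a = 0" and "regular s a 0 = 0"
    and "regular s (regular s a b) c = regular s a (regular s b c)"
  by (cases s; simp add: algebra_simps)+

lemma regular_sum_right:
  fixes f :: "'i \<Rightarrow> 'a::ring_1"
  shows "regular s a (sum f I) = (\<Sum>i\<in>I. regular s a (f i))"
  by (cases s) (simp_all add: sum_distrib_left sum_distrib_right)

lemma regular_sum_left:
  fixes f :: "'i \<Rightarrow> 'a::ring_1"
  shows "regular s (sum f I) a = (\<Sum>i\<in>I. regular s (f i) a)"
  by (cases s) (simp_all add: sum_distrib_left sum_distrib_right)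

lemma ring_module_regular: "ring_module s (regular s :: 'a::ring_1 \<Rightarrow> 'a \<Rightarrow> 'a)"
  by unfold_locales (simp_all add: regular_simps)

lemma ring_module_seq_act: "ring_module s (seq_act s :: 'a::ring_1 \<Rightarrow> (nat \<Rightarrow> 'a) \<Rightarrow> nat \<Rightarrow> 'a)"
  by unfold_locales (simp_all add: seq_act_def fun_eq_iff regular_simps)

section \<open>Submodules and cyclic modules\<close>

context ring_module
begin

lemma act_zero_right [simp]: "act a 0 = 0"
  using act_add_right[of a 0 0] by simp

lemma act_zero_left [simp]: "act 0 x = 0"
  using act_add_left[of 0 0 x] by simp

lemma act_minus: "act (- a) x = - act a x"
  using act_add_left[of a "- a" x] by (simp add: eq_neg_iff_add_eq_0 add.commute)

lemma act_diff: "act (a - b) x = act a x - act b x"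
  using act_add_left[of a "- b" x] by (simp add: act_minus)

lemma act_sum_left: "act (sum f I) x = (\<Sum>i\<in>I. act (f i) x)"
  by (induction I rule: infinite_finite_induct) (simp_all add: act_add_left)

lemma submodule_sum:
  assumes "submodule act N" "\<And>i. i \<in> I \<Longrightarrow> f i \<in> N"
  shows "sum f I \<in> N"
  using assms(2)
  by (induction I rule: infinite_finite_induct) (use assms(1) in \<open>auto simp: submodule_def\<close>)

lemma submodule_UNIV: "submodule act UNIV"
  by (simp add: submodule_def)

lemma submodule_hull: "submodule act (submodule act hull F)"
  unfolding hull_def submodule_def by blast

lemma submodule_cyclic: "submodule act (range (\<lambda>a. act a x))"
  unfolding submodule_def
proof (intro conjI ballI allI)
  show "0 \<in> range (\<lambda>a. act a x)"
    by (rule range_eqI[of _ _ 0]) simp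
next
  fix u v assume "u \<in> range (\<lambda>a. act a x)" "v \<in> range (\<lambda>a. act a x)"
  then show "u + v \<in> range (\<lambda>a. act a x)"
    by (auto simp flip: act_add_left)
next
  fix b u assume "u \<in> range (\<lambda>a. act a x)"
  then show "act b u \<in> range (\<lambda>a. act a x)"
    by (auto simp flip: act_act)
qed

lemma submodule_annihilator: "submodule (regular s) {a. act a x = 0}"
  by (auto simp: submodule_def act_add_left act_act)

lemma cyclic_eq_hull: "range (\<lambda>a. act a x) = submodule act hull {x}"
proof
  show "range (\<lambda>a. act a x) \<subseteq> submodule act hull {x}"
    using submodule_hull[of "{x}"] hull_subset[of "{x}" "submodule act"]
    by (auto simp: submodule_def)
  have "x \<in> range (\<lambda>a. act a x)"
    using act_one[of x] by (metis rangeI)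
  then show "submodule act hull {x} \<subseteq> range (\<lambda>a. act a x)"
    by (intro hull_minimal submodule_cyclic) simp
qed

lemma finitely_generated_cyclic: "finitely_generated act (range (\<lambda>a. act a x))"
  unfolding finitely_generated_def using cyclic_eq_hull[of x] by blast

lemma simple_module_cyclic:
  assumes "simple_module act" "x \<noteq> 0"
  shows "range (\<lambda>a. act a x) = UNIV"
proof -
  have "x \<in> range (\<lambda>a. act a x)"
    using act_one[of x] by (metis rangeI)
  with assms submodule_cyclic[of x] show ?thesis
    unfolding simple_module_def by fastforce
qed

end

section \<open>Homomorphisms and generated submodules\<close>

lemma hom_on_zero:
  assumes "hom_on act M act' N \<phi>" "0 \<in> M"
  shows "\<phi> 0 = 0"
proof -
  have "\<phi> (0 + 0) = \<phi> 0 + \<phi> 0"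
    using assms unfolding hom_on_def by blast
  then show ?thesis by simp
qed

lemma hom_on_sum:
  assumes "ring_module s act" "submodule act M" "hom_on act M act' N \<phi>"
    and "\<And>i. i \<in> I \<Longrightarrow> f i \<in> M"
  shows "\<phi> (sum f I) = (\<Sum>i\<in>I. \<phi> (f i))"
proof -
  interpret ring_module s act by fact
  have zero: "\<phi> 0 = 0"
    using assms(2,3) by (auto intro: hom_on_zero simp: submodule_def)
  show ?thesis
    using assms(4)
  proof (induction I rule: infinite_finite_induct)
    case (insert i I)
    have "f i \<in> M" "sum f I \<in> M"
      using insert.prems by (auto intro: submodule_sum[OF assms(2)])
    then show ?case
      using insert assms(3) by (simp add: hom_on_def)
  qed (simp_all add: zero)
qed

text \<open>Both inclusions come from minimality of a hull: the elements of \<open>M\<close> mapped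
  into the right side form a submodule containing \<open>F\<close>, and the left side is itself a
  submodule. Everything stays inside \<open>M\<close>, because \<open>\<phi>\<close> respects sums
  and the action only there.\<close>

lemma hull_image:
  assumes "ring_module s act" "ring_module s act'"
    and "submodule act M" "hom_on act M act' N \<phi>" "F \<subseteq> M"
  shows "\<phi> ` (submodule act hull F) = submodule act' hull (\<phi> ` F)"
proof
  interpret A: ring_module s act by fact
  interpret B: ring_module s act' by fact
  let ?H = "submodule act hull F" and ?H' = "submodule act' hull (\<phi> ` F)"
  have zero: "\<phi> 0 = 0"
    using assms(3,4) by (auto intro: hom_on_zero simp: submodule_def)
  have H: "submodule act ?H" and H': "submodule act' ?H'"
    by (rule A.submodule_hull B.submodule_hull)+
  have HM: "?H \<subseteq> M"
    using assms by (intro hull_minimal)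
  have "submodule act {v\<in>M. \<phi> v \<in> ?H'}"
    using assms(3,4) H' zero unfolding submodule_def hom_on_def by auto
  moreover have "F \<subseteq> {v\<in>M. \<phi> v \<in> ?H'}"
    using assms(5) by (auto intro: hull_inc)
  ultimately have "?H \<subseteq> {v\<in>M. \<phi> v \<in> ?H'}"
    by (rule hull_minimal[rotated])
  then show "\<phi> ` ?H \<subseteq> ?H'" by blast
  have "x + y \<in> \<phi> ` ?H" if xy: "x \<in> \<phi> ` ?H" "y \<in> \<phi> ` ?H" for x y
  proof -
    obtain u v where uv: "u \<in> ?H" "v \<in> ?H" "x = \<phi> u" "y = \<phi> v"
      using xy by blast
    then have "x + y = \<phi> (u + v)"
      using HM assms(4) unfolding hom_on_def by (metis subsetD)
    with uv H show ?thesis unfolding submodule_def by blast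
  qed
  moreover have "act' a x \<in> \<phi> ` ?H" if "x \<in> \<phi> ` ?H" for a x
  proof -
    obtain u where u: "u \<in> ?H" "x = \<phi> u"
      using \<open>x \<in> \<phi> ` ?H\<close> by blast
    then have "act' a x = \<phi> (act a u)"
      using HM assms(4) unfolding hom_on_def by (metis subsetD)
    with u H show ?thesis unfolding submodule_def by blast
  qed
  moreover have "0 \<in> \<phi> ` ?H"
    using H zero by (metis submodule_def image_eqI)
  ultimately have "submodule act' (\<phi> ` ?H)"
    by (simp add: submodule_def)
  then show "?H' \<subseteq> \<phi> ` ?H"
    by (intro hull_minimal) (auto intro: hull_inc)
qed

lemma finitely_generated_image:
  assumes "ring_module s act" "ring_module s act'"
    and "submodule act M" "hom_on act M act' N \<phi>"
    and "finitely_generated act K" "K \<subseteq> M"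
  shows "finitely_generated act' (\<phi> ` K)"
proof -
  obtain F where F: "finite F" "submodule act hull F = K"
    using assms(5) unfolding finitely_generated_def by blast
  then have "F \<subseteq> M"
    using assms(6) hull_subset[of F "submodule act"] by blast
  from hull_image[OF assms(1-4) this] F show ?thesis
    unfolding finitely_generated_def by (metis finite_imageI)
qed

section \<open>Finite presentations of cyclic and simple modules\<close>

lemma submodule_free_module: "submodule (seq_act s) (free_module n)"
  by (auto simp: submodule_def free_module_def seq_act_def regular_simps)

text \<open>A free entry lets one function give both the basis vector \<open>unit_seq i 1\<close>
  and the embedding \<open>unit_seq i\<close> of the ring as a coordinate.\<close>

definition unit_seq :: "nat \<Rightarrow> 'a::ring_1 \<Rightarrow> nat \<Rightarrow> 'a" where
  "unit_seq i a = (\<lambda>j. if j = i then a else 0)"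

lemma unit_seq_in_free_module: "i < n \<Longrightarrow> unit_seq i a \<in> free_module n"
  by (simp add: unit_seq_def free_module_def)

lemma seq_act_unit_seq: "seq_act s a (unit_seq i b) = unit_seq i (regular s a b)"
  by (auto simp: seq_act_def unit_seq_def regular_simps)

lemma sum_fun_apply: "(\<Sum>i\<in>I. f i) j = (\<Sum>i\<in>I. f i j)"
  by (induction I rule: infinite_finite_induct) auto

lemma free_module_expand:
  assumes "v \<in> free_module n"
  shows "v = (\<Sum>i<n. seq_act s (v i) (unit_seq i 1))"
proof
  fix j
  have "(\<Sum>i<n. seq_act s (v i) (unit_seq i 1)) j = (\<Sum>i<n. if j = i then v i else 0)"
    unfolding sum_fun_apply seq_act_unit_seq
    by (intro sum.cong) (simp_all add: unit_seq_def regular_simps)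
  also have "\<dots> = v j"
    using assms by (simp add: free_module_def)
  finally show "v j = (\<Sum>i<n. seq_act s (v i) (unit_seq i 1)) j" by simp
qed

text \<open>The presentation is the rank one map \<open>a \<mapsto> act a x\<close>; its kernel is
  the annihilator, transported into sequences by \<open>unit_seq 0\<close>.\<close>

lemma finitely_presented_cyclic:
  assumes "ring_module s act" "finitely_generated (regular s) {a. act a x = 0}"
  shows "finitely_presented s act (range (\<lambda>a. act a x))"
proof -
  interpret ring_module s act by fact
  define \<phi> where "\<phi> v = act (v (0::nat)) x" for v
  have free1: "free_module 1 = range (unit_seq 0 :: 'a \<Rightarrow> nat \<Rightarrow> 'a)"
  proof -
    have "v = unit_seq 0 (v 0)" if "v \<in> free_module 1" for v :: "nat \<Rightarrow> 'a"
      using that by (auto simp: free_module_def unit_seq_def)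
    then show ?thesis using unit_seq_in_free_module[of 0 1] by auto
  qed
  have hom: "hom_on (seq_act s) (free_module 1) act (range (\<lambda>a. act a x)) \<phi>"
    by (auto simp: hom_on_def \<phi>_def seq_act_def act_add_left act_act)
  have onto: "\<phi> ` free_module 1 = range (\<lambda>a. act a x)"
    unfolding free1 by (simp add: image_image \<phi>_def unit_seq_def)
  have ker: "{v \<in> free_module 1. \<phi> v = 0} = unit_seq 0 ` {a. act a x = 0}"
    unfolding free1 by (auto simp: \<phi>_def unit_seq_def)
  have "hom_on (regular s) UNIV (seq_act s) UNIV (unit_seq 0 :: 'a \<Rightarrow> nat \<Rightarrow> 'a)"
    by (auto simp: hom_on_def seq_act_unit_seq) (auto simp: unit_seq_def fun_eq_iff)
  then have "finitely_generated (seq_act s) (unit_seq 0 ` {a. act a x = 0})"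
    using finitely_generated_image[OF ring_module_regular ring_module_seq_act
        ring_module.submodule_UNIV[OF ring_module_regular] _ assms(2)] by blast
  then have "finitely_generated (seq_act s) {v \<in> free_module 1. \<phi> v = 0}"
    by (simp only: ker)
  with hom onto show ?thesis
    unfolding finitely_presented_def by blast
qed

text \<open>A presentation of rank \<open>n\<close> is cut down to rank one. Some basis vector has
  nonzero image \<open>x\<close>, which generates the simple module, so \<open>\<phi>\<close>
  factors through \<open>a \<mapsto> act a x\<close> by a map \<open>p\<close> from the free module
  to the ring; \<open>p\<close> carries the kernel of \<open>\<phi>\<close> onto the annihilator of
  \<open>x\<close>.\<close>

lemma finitely_presented_simple_annihilator:
  assumes "ring_module s act" "simple_module act" "finitely_presented s act UNIV"
  obtains x where "x \<noteq> 0" "finitely_generated (regular s) {a. act a x = 0}"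
proof -
  interpret ring_module s act by fact
  obtain n \<phi> where hom: "hom_on (seq_act s) (free_module n) act UNIV \<phi>"
    and onto: "\<phi> ` free_module n = UNIV"
    and fg: "finitely_generated (seq_act s) {v \<in> free_module n. \<phi> v = 0}"
    using assms(3) unfolding finitely_presented_def by blast
  let ?e = "\<lambda>i. unit_seq i 1"
  have \<phi>_expand: "\<phi> v = (\<Sum>i<n. act (v i) (\<phi> (?e i)))" if v: "v \<in> free_module n" for v
  proof -
    have "\<phi> v = \<phi> (\<Sum>i<n. seq_act s (v i) (?e i))"
      using free_module_expand[OF v] by metis
    also have "\<dots> = (\<Sum>i<n. \<phi> (seq_act s (v i) (?e i)))"
      by (rule hom_on_sum[OF ring_module_seq_act submodule_free_module hom])
        (simp add: seq_act_unit_seq unit_seq_in_free_module)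
    also have "\<dots> = (\<Sum>i<n. act (v i) (\<phi> (?e i)))"
      using hom by (intro sum.cong) (auto simp: hom_on_def unit_seq_in_free_module)
    finally show ?thesis .
  qed
  \<comment> \<open>If all basis vectors went to zero, so would everything, although
    \<open>\<phi>\<close> is onto a nonzero module.\<close>
  obtain i where i: "i < n" "\<phi> (?e i) \<noteq> 0"
  proof -
    obtain y :: 'b where "y \<noteq> 0"
      using assms(2) unfolding simple_module_def by auto
    moreover obtain v where "v \<in> free_module n" "y = \<phi> v"
      using onto by blast
    ultimately have "(\<Sum>i<n. act (v i) (\<phi> (?e i))) \<noteq> 0"
      using \<phi>_expand by simp
    then show ?thesis
      using that by (metis (no_types, lifting) act_zero_right lessThan_iff sum.neutral)
  qed
  define x where "x = \<phi> (?e i)"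
  have "\<exists>a. act a x = \<phi> (?e j)" for j
    using simple_module_cyclic[OF assms(2) i(2)] unfolding x_def by (metis rangeE UNIV_I)
  then obtain b where b: "\<And>j. act (b j) x = \<phi> (?e j)" by metis
  \<comment> \<open>Resetting the \<open>i\<close>-th coefficient to 1 makes
    \<open>unit_seq i\<close> a right inverse of \<open>p\<close>, which gives surjectivity onto the
    annihilator.\<close>
  define c where "c = b(i := 1)"
  have c: "act (c j) x = \<phi> (?e j)" for j
    using b[of j] by (cases "j = i") (simp_all add: c_def x_def act_one)
  define p where "p v = (\<Sum>j<n. regular s (v j) (c j))" for v
  have \<phi>_p: "\<phi> v = act (p v) x" if "v \<in> free_module n" for v
    using that by (simp add: \<phi>_expand p_def act_sum_left act_act c)
  have p_hom: "hom_on (seq_act s) (free_module n) (regular s) UNIV p"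
    by (auto simp: hom_on_def p_def seq_act_def regular_simps sum.distrib regular_sum_right)
  have "p ` {v \<in> free_module n. \<phi> v = 0} = {a. act a x = 0}"
  proof (intro set_eqI iffI)
    fix a assume a: "a \<in> {a. act a x = 0}"
    let ?v = "unit_seq i a"
    have "p ?v = (\<Sum>j<n. if j = i then a else 0)"
      unfolding p_def by (rule sum.cong) (auto simp: unit_seq_def regular_simps c_def)
    then have "p ?v = a" using i by simp
    moreover have "?v \<in> free_module n" using i by (simp add: unit_seq_in_free_module)
    ultimately show "a \<in> p ` {v \<in> free_module n. \<phi> v = 0}"
      using a \<phi>_p by (intro image_eqI[of _ _ ?v]) auto
  qed (auto simp: \<phi>_p)
  then have "finitely_generated (regular s) {a. act a x = 0}"
    using finitely_generated_image[OF ring_module_seq_act ring_module_regular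
        submodule_free_module p_hom fg] by auto
  with i that show thesis unfolding x_def by blast
qed


subsection \<open>Frobenius algebras\<close>

context k_algebra
begin

lemma linear_form_on_sum:
  assumes "linear_form_on R \<theta>" "subspace R" "\<And>i. i \<in> I \<Longrightarrow> f i \<in> R"
  shows "\<theta> (\<Sum>i\<in>I. c i *k f i) = (\<Sum>i\<in>I. c i * \<theta> (f i))"
proof -
  have zero: "\<theta> 0 = 0"
    using assms(1) subspace_0[OF assms(2)] unfolding linear_form_on_def
    by (metis add_cancel_right_right)
  show ?thesis
    using assms(3)
  proof (induction I rule: infinite_finite_induct)
    case (insert i I)
    have "c i *k f i \<in> R" "(\<Sum>i\<in>I. c i *k f i) \<in> R"
      using insert.prems by (auto intro!: subspace_sum subspace_scale assms(2))
    then show ?case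
      using insert assms(1) by (simp add: linear_form_on_def)
  qed (simp_all add: zero)
qed

text \<open>The matrix of a nondegenerate form in a basis \<open>B\<close> is invertible: the linear map
  \<open>r \<mapsto> (\<Sum>b\<in>B. \<theta> (b r) *k b)\<close> is injective, hence onto, on the span of \<open>B\<close>.\<close>

lemma frobenius_form_dual:
  assumes R: "subalgebra R" and \<theta>: "frobenius_form R \<theta>"
    and B: "finite B" "independent B" "span B = R" and e: "e \<in> B"
  obtains r where "r \<in> R" "\<And>b. b \<in> B \<Longrightarrow> \<theta> (b * r) = (if b = e then 1 else 0)"
proof -
  have lin: "linear_form_on R \<theta>" and nondeg: "\<And>y. y \<in> R \<Longrightarrow> (\<forall>x\<in>R. \<theta> (x * y) = 0) \<Longrightarrow> y = 0"
    using \<theta> by (auto simp: frobenius_form_def)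
  have subR: "subspace R" and mult: "\<And>x y. x \<in> R \<Longrightarrow> y \<in> R \<Longrightarrow> x * y \<in> R"
    using R by (auto simp: subalgebra_def)
  have BR: "b \<in> R" if "b \<in> B" for b
    using that B(3) span_base by blast
  define T where "T r = (\<Sum>b\<in>B. \<theta> (b * r) *k b)" for r
  have T_lin: "T (\<Sum>d\<in>B. u d *k d) = (\<Sum>d\<in>B. u d *k T d)" for u
  proof -
    have "\<theta> (b * (\<Sum>d\<in>B. u d *k d)) = (\<Sum>d\<in>B. u d * \<theta> (b * d))" if "b \<in> B" for b
      unfolding sum_distrib_left scale_mult_right
      by (rule linear_form_on_sum[OF lin subR]) (auto intro: mult BR that)
    then have "T (\<Sum>d\<in>B. u d *k d) = (\<Sum>b\<in>B. \<Sum>d\<in>B. (u d * \<theta> (b * d)) *k b)"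
      unfolding T_def by (simp add: scale_sum_left)
    also have "\<dots> = (\<Sum>d\<in>B. \<Sum>b\<in>B. (u d * \<theta> (b * d)) *k b)"
      by (rule sum.swap)
    also have "\<dots> = (\<Sum>d\<in>B. u d *k T d)"
      by (simp add: T_def scale_sum_right)
    finally show ?thesis .
  qed
  have T_coord: "\<theta> (b * r) = u b" if "T r = (\<Sum>b\<in>B. u b *k b)" "b \<in> B" for r u b
  proof -
    have "(\<Sum>b\<in>B. (\<theta> (b * r) - u b) *k b) = 0"
      using that(1) unfolding T_def by (simp add: scale_left_diff_distrib sum_subtractf)
    then show ?thesis
      using independentD[OF B(2,1) order_refl, of "\<lambda>b. \<theta> (b * r) - u b" b] that(2) by simp
  qed
  \<comment> \<open>A zero image makes every basis element, hence all of \<open>R\<close>,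
    orthogonal to \<open>r\<close>.\<close>
  have ker: "r = 0" if "r \<in> R" "T r = 0" for r
  proof (rule nondeg[OF that(1)], rule ballI)
    fix x assume "x \<in> R"
    then obtain u where u: "x = (\<Sum>b\<in>B. u b *k b)"
      using B(3) span_finite[OF B(1)] by auto
    have 0: "\<theta> (b * r) = 0" if "b \<in> B" for b
      using T_coord[of r "\<lambda>_. 0" b] that \<open>T r = 0\<close> by simp
    have "\<theta> (x * r) = (\<Sum>b\<in>B. u b * \<theta> (b * r))"
      unfolding u sum_distrib_right scale_mult_left
      by (rule linear_form_on_sum[OF lin subR]) (auto intro: mult BR that)
    then show "\<theta> (x * r) = 0" using 0 by simp
  qed
  have indep_coeffs: "u d = 0" if "(\<Sum>d\<in>B. u d *k T d) = 0" "d \<in> B" for u d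
  proof -
    have "(\<Sum>d\<in>B. u d *k d) \<in> R"
      using BR by (auto intro!: subspace_sum subspace_scale subR)
    then have "(\<Sum>d\<in>B. u d *k d) = 0" by (rule ker) (simp add: T_lin that)
    then show ?thesis using independentD[OF B(2,1) order_refl] that(2) by blast
  qed
  \<comment> \<open>Independence below is that of the image as a set, so a collision
    \<open>T x = T y\<close> has to be excluded: it is a relation with coefficients 1 and
    -1.\<close>
  have inj: "inj_on T B"
  proof (rule inj_onI, rule ccontr)
    fix x y assume xy: "x \<in> B" "y \<in> B" "T x = T y" "x \<noteq> y"
    define u where "u d = (if d = x then 1 else if d = y then -1 else 0 :: 'k)" for d
    have "(\<Sum>d\<in>B. u d *k T d) = (\<Sum>d\<in>{x,y}. u d *k T d)"
      using xy B(1) by (intro sum.mono_neutral_right) (auto simp: u_def)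
    also have "\<dots> = 0" using xy by (simp add: u_def)
    finally have "u x = 0" using indep_coeffs xy(1) by blast
    then show False by (simp add: u_def)
  qed
  have indep: "independent (T ` B)"
  proof (rule independent_if_scalars_zero)
    fix f x assume "(\<Sum>x\<in>T ` B. f x *k x) = 0" "x \<in> T ` B"
    then show "f x = 0"
      using indep_coeffs[of "f \<circ> T"] by (auto simp: sum.reindex[OF inj])
  qed (use B in simp)
  have TR: "T r \<in> R" for r
    unfolding T_def using BR by (auto intro!: subspace_sum subspace_scale subR)
  \<comment> \<open>Dimension count: otherwise \<open>e\<close> and the image of \<open>B\<close>
    would be \<open>card B + 1\<close> independent vectors in \<open>span B\<close>.\<close>
  have "e \<in> span (T ` B)"
  proof (rule ccontr)
    assume e': "e \<notin> span (T ` B)"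
    then have "independent (insert e (T ` B))"
      using indep by (simp add: independent_insertI)
    moreover have "insert e (T ` B) \<subseteq> span B"
      using B(3) TR BR e by auto
    ultimately have "card (insert e (T ` B)) \<le> card B"
      using independent_span_bound B(1) by blast
    moreover have "e \<notin> T ` B" using e' span_base by blast
    ultimately show False
      using B(1) by (simp add: card_image[OF inj])
  qed
  then obtain w where "e = (\<Sum>x\<in>T ` B. w x *k x)"
    using B(1) span_finite[of "T ` B"] by auto
  then have w: "e = (\<Sum>d\<in>B. w (T d) *k T d)"
    by (simp add: sum.reindex[OF inj])
  \<comment> \<open>The coefficients of \<open>e\<close> over the vectors \<open>T d\<close>, used
    over the \<open>d\<close> themselves, give \<open>T r = e\<close>; comparing coordinates in
    \<open>B\<close> yields the values of the form.\<close>
  define r where "r = (\<Sum>d\<in>B. w (T d) *k d)"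
  have "r \<in> R"
    unfolding r_def using BR by (auto intro!: subspace_sum subspace_scale subR)
  have "T r = (\<Sum>b\<in>B. (if b = e then 1 else 0) *k b)"
    unfolding r_def T_lin using w e B(1)
    by (simp add: if_distrib[of "\<lambda>c. c *k _"] cong: if_cong)
  from that[OF \<open>r \<in> R\<close> T_coord[OF this]] show thesis .
qed

lemma finite_basis_extend:
  assumes "finite F" "V \<subseteq> span F" "independent S" "S \<subseteq> V" "subspace V"
  obtains B where "S \<subseteq> B" "finite B" "independent B" "span B = V"
proof -
  obtain B where B: "S \<subseteq> B" "B \<subseteq> V" "independent B" "V \<subseteq> span B"
    using maximal_independent_subset_extend[OF assms(4,3)] by blast
  moreover have "finite B"
    using independent_span_bound[OF assms(1) B(3)] B(2) assms(2) by blast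
  moreover have "span B = V"
    using B(2,4) span_minimal[OF B(2) assms(5)] by blast
  ultimately show thesis using that by blast
qed

text \<open>A scalar acts as multiplication by \<open>c *k 1\<close>, from either side.\<close>

lemma submodule_regular_subspace:
  assumes "submodule (regular s) L"
  shows "subspace L"
proof -
  have "c *k x = regular s (c *k 1) x" for c x
    by (cases s) (simp_all add: scale_mult_left scale_mult_right)
  with assms show ?thesis
    unfolding subspace_def submodule_def by metis
qed

text \<open>As \<open>1 \<notin> L\<close>, a basis of \<open>R \<inter> L\<close> and 1 extend
  together to a basis of \<open>R\<close>; \<open>r\<close> is the element dual to 1. The form
  vanishes on \<open>x * r\<close> for \<open>x\<close> in \<open>R \<inter> L\<close>, and the
  ideal property turns this into orthogonality of \<open>R\<close> to \<open>regular s x r\<close>,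
  hence into vanishing.\<close>

lemma symmetric_frobenius_orthogonal:
  assumes R: "symmetric_frobenius R"
    and L: "submodule (regular s) L" "1 \<notin> L"
  obtains r where "r \<in> R" "r \<noteq> 0" "\<forall>x\<in>R \<inter> L. regular s x r = 0"
proof -
  obtain F \<theta> where alg: "subalgebra R" and F: "finite F" "span F = R"
    and \<theta>: "frobenius_form R \<theta>" and sym: "\<And>x y. x \<in> R \<Longrightarrow> y \<in> R \<Longrightarrow> \<theta> (x * y) = \<theta> (y * x)"
    using R unfolding symmetric_frobenius_def by blast
  have subR: "subspace R" and mult: "\<And>x y. x \<in> R \<Longrightarrow> y \<in> R \<Longrightarrow> x * y \<in> R" and "1 \<in> R"
    using alg by (auto simp: subalgebra_def)
  have regR: "regular s x y \<in> R" if "x \<in> R" "y \<in> R" for x y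
    using mult that by (cases s) auto
  \<comment> \<open>Under \<open>\<theta>\<close>, symmetry removes the difference between the two
    sides.\<close>
  have sym': "\<theta> (regular s x y) = \<theta> (x * y)" if "x \<in> R" "y \<in> R" for x y
    using sym that by (cases s) auto
  have subRL: "subspace (R \<inter> L)"
    using subR submodule_regular_subspace[OF L(1)] by (rule subspace_inter)
  obtain B0 where B0: "finite B0" "independent B0" "span B0 = R \<inter> L"
    using finite_basis_extend[OF F(1) _ independent_empty _ subRL] F(2) by auto
  have indep1: "independent (insert 1 B0)"
    using B0(2,3) L(2) independent_insertI by blast
  have sub1: "insert 1 B0 \<subseteq> R"
    using B0(3) \<open>1 \<in> R\<close> span_superset by blast
  obtain B where B: "insert 1 B0 \<subseteq> B" "finite B" "independent B" "span B = R"
    using finite_basis_extend[OF F(1) _ indep1 sub1 subR] F(2) by blast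
  then have "1 \<in> B" by simp
  then obtain r where r: "r \<in> R" "\<And>b. b \<in> B \<Longrightarrow> \<theta> (b * r) = (if b = 1 then 1 else 0)"
    using frobenius_form_dual[OF alg \<theta> B(2-4)] by blast
  have lin: "linear_form_on R \<theta>" using \<theta> by (simp add: frobenius_form_def)
  have orth: "\<theta> (x * r) = 0" if "x \<in> R" "x \<in> L" for x
  proof -
    have "x \<in> span B0" using that B0(3) by blast
    then obtain u where u: "x = (\<Sum>b\<in>B0. u b *k b)"
      using span_finite[OF B0(1)] by auto
    have "\<theta> (x * r) = (\<Sum>b\<in>B0. u b * \<theta> (b * r))"
      unfolding u sum_distrib_right scale_mult_left
      using B0(3) span_superset r(1)
      by (intro linear_form_on_sum[OF lin subR]) (auto intro: mult)
    moreover have "\<theta> (b * r) = 0" if "b \<in> B0" for b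
    proof -
      have "b \<noteq> 1" using that B0(3) span_superset L(2) by blast
      then show ?thesis using r(2) that B(1) by auto
    qed
    ultimately show ?thesis by simp
  qed
  have "r \<noteq> 0"
  proof
    assume "r = 0"
    moreover have "\<theta> 0 = 0"
      using linear_form_on_sum[OF lin subR, of "{}"] by simp
    ultimately show False using r(2)[OF \<open>1 \<in> B\<close>] by simp
  qed
  moreover have "regular s x r = 0" if x: "x \<in> R" "x \<in> L" for x
  proof -
    \<comment> \<open>Multiplying \<open>x\<close> by \<open>y\<close> stays in \<open>L\<close>;
      associativity then moves \<open>y\<close> to the outside, where it is an arbitrary test
      element against \<open>regular s x r\<close>.\<close>
    have "\<theta> (y * regular s x r) = 0" if y: "y \<in> R" for y
    proof -
      have "regular s y x \<in> L" using L(1) x by (simp add: submodule_def)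
      then have "\<theta> (regular s y x * r) = 0" using orth regR x y by blast
      then have "\<theta> (regular s (regular s y x) r) = 0" using sym' regR x y r(1) by simp
      then have "\<theta> (regular s y (regular s x r)) = 0" by (simp only: regular_simps)
      then show ?thesis using sym' regR x y r(1) by simp
    qed
    then show ?thesis
      using \<theta> regR x r(1) unfolding frobenius_form_def by blast
  qed
  ultimately show thesis using that r(1) by blast
qed


subsection \<open>Annihilators and free extensions\<close>

fun opposite :: "side \<Rightarrow> side" where
  "opposite Left = Right"
| "opposite Right = Left"

lemma regular_opposite: "regular (opposite s) a b = regular s b (a :: 'b::times)"
  by (cases s) simp_all

text \<open>Coordinates of \<open>c\<close> over \<open>B\<close> have to be taken on the side where \<open>B\<close> acts next to \<open>x\<close>.\<close>

lemma free_over_annihilator: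
  fixes B C :: "'b::ring_1 set"
  assumes free: "free_over (opposite s) B C" and "c \<in> C" "0 \<in> B" "0 \<in> C"
    and B: "\<And>b. b \<in> B \<Longrightarrow> regular s b x \<in> B" and c: "regular s c x = 0"
  obtains X f where "finite X" "\<And>b. f b \<in> B" "\<And>b. regular s (f b) x = 0"
    "c = (\<Sum>b\<in>X. regular s b (f b))"
proof -
  obtain X where X: "\<forall>c\<in>C. \<exists>!f. range f \<subseteq> B \<and> finite {x. f x \<noteq> 0} \<and>
      {x. f x \<noteq> 0} \<subseteq> X \<and> c = (\<Sum>x | f x \<noteq> 0. regular s x (f x))"
    using free unfolding free_over_def regular_opposite by (elim exE conjE) (rule that)
  define P where "P c f \<longleftrightarrow> range f \<subseteq> B \<and> finite {x. f x \<noteq> 0} \<and>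
      {x. f x \<noteq> 0} \<subseteq> X \<and> c = (\<Sum>x | f x \<noteq> 0. regular s x (f x))" for c f
  have ex1: "\<exists>!f. P c f" if "c \<in> C" for c
    using X that unfolding P_def by (rule bspec)
  obtain f where "P c f"
    using ex1[OF \<open>c \<in> C\<close>] by blast
  then have f: "range f \<subseteq> B" "finite {x. f x \<noteq> 0}" "{x. f x \<noteq> 0} \<subseteq> X"
      "c = (\<Sum>x | f x \<noteq> 0. regular s x (f x))"
    unfolding P_def by blast+
  \<comment> \<open>Multiplying the expansion of \<open>c\<close> by \<open>x\<close> replaces the
    coordinates \<open>f\<close> by \<open>g\<close>, still in \<open>B\<close>; these are
    coordinates of 0.\<close>
  define g where "g b = regular s (f b) x" for b
  have supp: "{b. g b \<noteq> 0} \<subseteq> {b. f b \<noteq> 0}"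
    by (auto simp: g_def regular_simps)
  have "0 = (\<Sum>b | f b \<noteq> 0. regular s b (g b))"
    using c by (subst (asm) f(4)) (simp add: regular_sum_left regular_simps g_def)
  \<comment> \<open>Coordinates are summed over their exact support, which may shrink on passing
    from \<open>f\<close> to \<open>g\<close>.\<close>
  also have "\<dots> = (\<Sum>b | g b \<noteq> 0. regular s b (g b))"
    using supp f(2) by (intro sum.mono_neutral_right) (auto simp: regular_simps)
  finally have "P 0 g"
    unfolding P_def using f(1) B finite_subset[OF supp f(2)] supp f(3) by (auto simp: g_def)
  moreover have "P 0 (\<lambda>_. 0)"
    unfolding P_def using \<open>0 \<in> B\<close> by auto
  \<comment> \<open>Uniqueness of the coordinates of 0 makes each single coordinate of
    \<open>c\<close> annihilate \<open>x\<close>.\<close>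
  ultimately have "g = (\<lambda>_. 0)"
    using ex1[OF \<open>0 \<in> C\<close>] by blast
  then have "regular s (f b) x = 0" for b
    by (simp add: g_def fun_eq_iff)
  with f that show thesis by blast
qed

section \<open>From finite stages to the locally Frobenius algebra\<close>

lemma locally_frobenius_system:
  fixes l0 :: "'l::order"
  assumes "shape l0" "locally_frobenius l0"
  obtains A :: "'l \<Rightarrow> 'a set" where
    "\<And>l. symmetric_frobenius (A l)" "\<And>l m. l \<le> m \<Longrightarrow> A l \<subseteq> A m"
    "\<And>G. finite G \<Longrightarrow> \<exists>l. G \<subseteq> A l"
    "\<And>l m. l < m \<Longrightarrow> free_frobenius_extension (A l) (A m)"
proof -
  obtain A :: "'l \<Rightarrow> 'a set" and \<epsilon> :: "'l \<Rightarrow> 'a \<Rightarrow> 'k" where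
    frob: "\<forall>l. symmetric_frobenius (A l) \<and> augmentation_on (A l) (\<epsilon> l)"
    and incl: "\<forall>l m. l < m \<longrightarrow> A l \<subset> A m \<and> (\<forall>x\<in>A l. \<epsilon> m x = \<epsilon> l x)"
    and union: "(\<Union>l. A l) = UNIV"
    and ext: "\<forall>l m. l < m \<longrightarrow> free_frobenius_extension (A l) (A m)"
    using assms(2) unfolding locally_frobenius_def by blast
  have mono: "A l \<subseteq> A m" if "l \<le> m" for l m
    using incl that unfolding le_less by blast
  \<comment> \<open>Each added element costs one use of directedness.\<close>
  have "\<exists>l. G \<subseteq> A l" if "finite G" for G
    using that
  proof (induction G)
    case (insert x G)
    then obtain l m where "G \<subseteq> A l" "x \<in> A m" using union by blast
    moreover obtain u where "l \<le> u" "m \<le> u" using assms(1) unfolding shape_def by blast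
    ultimately show ?case using mono by blast
  qed simp
  with that frob mono ext show thesis by blast
qed

text \<open>The generators are chosen once: a finite set \<open>F\<close> spanning the annihilator
  inside a stage \<open>A l\<close> that contains \<open>x\<close>. Any annihilating element lies in
  some larger stage, and its coordinates over \<open>A l\<close> annihilate \<open>x\<close>, so
  they lie in the span of \<open>F\<close>.\<close>

lemma locally_frobenius_annihilator_finitely_generated:
  fixes l0 :: "'l::order" and x :: 'a
  assumes "shape l0" "locally_frobenius l0"
  shows "finitely_generated (regular s) {a. regular s a x = 0}"
proof -
  obtain A :: "'l \<Rightarrow> 'a set" where A: "\<And>l. symmetric_frobenius (A l)"
    "\<And>l m. l \<le> m \<Longrightarrow> A l \<subseteq> A m" "\<And>G. finite G \<Longrightarrow> \<exists>l. G \<subseteq> A l"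
    "\<And>l m. l < m \<Longrightarrow> free_frobenius_extension (A l) (A m)"
    using locally_frobenius_system[OF assms] by blast
  interpret reg: ring_module s "regular s :: 'a \<Rightarrow> 'a \<Rightarrow> 'a" by (rule ring_module_regular)
  let ?Ann = "{a. regular s a x = 0}"
  obtain l where l: "x \<in> A l" using A(3)[of "{x}"] by auto
  obtain E where E: "finite E" "span E = A l" and alg: "subalgebra (A l)"
    using A(1)[of l] unfolding symmetric_frobenius_def by blast
  have sub: "subspace (A m)" for m
    using A(1)[of m] by (simp add: symmetric_frobenius_def subalgebra_def)
  have Ann: "submodule (regular s) ?Ann" by (rule reg.submodule_annihilator)
  then have subAnn: "subspace (A l \<inter> ?Ann)"
    by (intro subspace_inter sub submodule_regular_subspace)
  have "A l \<inter> ?Ann \<subseteq> span E" using E(2) by blast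
  then obtain F where F: "finite F" "span F = A l \<inter> ?Ann"
    by (rule finite_basis_extend[OF E(1) _ independent_empty empty_subsetI subAnn])
  let ?H = "submodule (regular s) hull F"
  have H: "submodule (regular s) ?H" by (rule reg.submodule_hull)
  then have spanH: "span F \<subseteq> ?H"
    by (intro span_minimal hull_subset submodule_regular_subspace)
  have "?Ann \<subseteq> ?H"
  proof
    fix a assume a: "a \<in> ?Ann"
    obtain m where "a \<in> A m" using A(3)[of "{a}"] by auto
    \<comment> \<open>Freeness is given for strict inclusions, so a stage strictly above the common
      bound is taken; the shape has no maximal element.\<close>
    moreover obtain u v where "l \<le> u" "m \<le> u" "u < v"
      using assms(1) unfolding shape_def by blast
    ultimately have v: "l < v" "a \<in> A v" using A(2)[of m v] order_le_less_trans less_imp_le by blast+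
    then have "free_over (opposite s) (A l) (A v)"
      using A(4) by (cases s) (auto simp: free_frobenius_extension_def)
    moreover have "regular s b x \<in> A l" if "b \<in> A l" for b
      using alg l that by (cases s) (auto simp: subalgebra_def)
    ultimately obtain X f where f: "finite X" "\<And>b. f b \<in> A l" "\<And>b. regular s (f b) x = 0"
        "a = (\<Sum>b\<in>X. regular s b (f b))"
      using a free_over_annihilator[of s "A l" "A v" a x] v subspace_0[OF sub] by auto
    then have "f b \<in> ?H" for b using spanH F(2) by blast
    then show "a \<in> ?H"
      unfolding f(4) using H by (intro reg.submodule_sum[OF H]) (simp add: submodule_def)
  qed
  moreover have "?H \<subseteq> ?Ann"
    using F(2) span_superset by (intro hull_minimal Ann) blast
  ultimately show ?thesis
    unfolding finitely_generated_def using F(1) by blast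
qed

text \<open>Finitely many generators of \<open>L\<close> fit into one stage, which contains a
  nonzero \<open>r\<close> annihilated by them; the elements annihilating \<open>r\<close> form a
  submodule, so this passes to all of \<open>L\<close>.\<close>

lemma locally_frobenius_proper_annihilated:
  fixes l0 :: "'l::order" and L :: "'a set"
  assumes "shape l0" "locally_frobenius l0"
    and L: "submodule (regular s) L" "finitely_generated (regular s) L" "1 \<notin> L"
  obtains r where "r \<noteq> 0" "\<And>x. x \<in> L \<Longrightarrow> regular s x r = 0"
proof -
  obtain A :: "'l \<Rightarrow> 'a set" where A: "\<And>l. symmetric_frobenius (A l)"
    "\<And>l m. l \<le> m \<Longrightarrow> A l \<subseteq> A m" "\<And>G. finite G \<Longrightarrow> \<exists>l. G \<subseteq> A l"
    "\<And>l m. l < m \<Longrightarrow> free_frobenius_extension (A l) (A m)"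
    using locally_frobenius_system[OF assms(1,2)] by blast
  obtain G where G: "finite G" "submodule (regular s) hull G = L"
    using L(2) unfolding finitely_generated_def by blast
  then obtain l where l: "G \<subseteq> A l" using A(3) by blast
  obtain r where r: "r \<in> A l" "r \<noteq> 0" "\<forall>x\<in>A l \<inter> L. regular s x r = 0"
    by (rule symmetric_frobenius_orthogonal[OF A(1)[of l] L(1,3)])
  have "G \<subseteq> L" unfolding G(2)[symmetric] by (rule hull_subset)
  then have "submodule (regular s) hull G \<subseteq> {x. regular s x r = 0}"
    using l r(3)
    by (intro hull_minimal ring_module.submodule_annihilator[OF ring_module_regular]) auto
  with G(2) r(2) that show thesis by blast
qed

end

section \<open>Coherence and embeddings of simple modules\<close>

lemma simple_module_coherent:
  assumes "ring_module s act" "simple_module act" "x \<noteq> 0"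
    and "finitely_generated (regular s) {a. act a x = 0}"
  shows "coherent s act UNIV"
proof -
  interpret ring_module s act by fact
  have gen: "range (\<lambda>a. act a x) = UNIV"
    by (rule simple_module_cyclic[OF assms(2,3)])
  \<comment> \<open>The whole ring is generated by 1 and is the annihilator of 0, so the zero
    submodule is finitely presented as the cyclic module on 0.\<close>
  have one: "range (\<lambda>a. regular s a 1) = (UNIV :: 'a set)"
    by (auto simp: regular_simps)
  have "finitely_generated (regular s) (UNIV :: 'a set)"
    using ring_module.finitely_generated_cyclic[OF ring_module_regular, of s "1 :: 'a"]
    by (simp only: one)
  then have "finitely_presented s act {0}"
    using finitely_presented_cyclic[OF assms(1), of 0] by simp
  moreover have "finitely_presented s act UNIV"
    using finitely_presented_cyclic[OF assms(1,4)] gen by simp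
  \<comment> \<open>Simplicity leaves just these two submodules to check.\<close>
  ultimately have "pseudo_coherent s act UNIV"
    using assms(2) unfolding pseudo_coherent_def simple_module_def by metis
  moreover have "finitely_generated act UNIV"
    using finitely_generated_cyclic[of x] gen by simp
  ultimately show ?thesis by (simp add: coherent_def)
qed

text \<open>The module is the quotient of the ring by the annihilator of \<open>x\<close>, which
  annihilates \<open>r\<close> too, so \<open>act a x \<mapsto> regular s a r\<close> is well
  defined; its kernel is a proper submodule, hence zero.\<close>

lemma simple_module_embeds:
  assumes "ring_module s act" "simple_module act" "x \<noteq> 0"
    and "r \<noteq> 0" and r: "\<And>a. act a x = 0 \<Longrightarrow> regular s a r = 0"
  shows "isomorphic act UNIV (regular s) (range (\<lambda>a. regular s a r))"
proof -
  interpret ring_module s act by fact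
  have gen: "range (\<lambda>a. act a x) = UNIV"
    by (rule simple_module_cyclic[OF assms(2,3)])
  have welldef: "regular s a r = regular s b r" if "act a x = act b x" for a b
    using r[of "a - b"] that by (simp add: act_diff regular_simps)
  \<comment> \<open>Any multiplier representing \<open>y\<close> may be chosen;
    \<open>welldef\<close> makes the choice immaterial.\<close>
  define \<psi> where "\<psi> y = regular s (SOME a. act a x = y) r" for y
  have \<psi>: "\<psi> (act a x) = regular s a r" for a
    unfolding \<psi>_def by (rule welldef, rule someI) (rule refl)
  have rep: "\<exists>a. y = act a x" for y using gen by blast
  have add: "\<psi> (y + z) = \<psi> y + \<psi> z" for y z
    using rep[of y] rep[of z] \<psi> by (metis act_add_left regular_simps(2))
  have smult: "\<psi> (act a y) = regular s a (\<psi> y)" for a y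
    using rep[of y] \<psi> by (metis act_act regular_simps(9))
  have zero: "\<psi> 0 = 0" using add[of 0 0] by simp
  have "submodule act {y. \<psi> y = 0}"
    by (auto simp: submodule_def add smult zero regular_simps)
  moreover have "\<psi> x \<noteq> 0"
    using \<psi>[of 1] \<open>r \<noteq> 0\<close> by (simp add: act_one regular_simps)
  ultimately have ker: "{y. \<psi> y = 0} = {0}"
    using assms(2) unfolding simple_module_def by blast
  have "inj \<psi>"
  proof (rule injI)
    fix y z assume "\<psi> y = \<psi> z"
    then have "\<psi> (y - z) = 0" using add[of "y - z" z] by simp
    then have "y - z = 0" using ker by blast
    then show "y = z" by simp
  qed
  moreover have range: "range \<psi> = range (\<lambda>a. regular s a r)"
    unfolding gen[symmetric] by (simp add: image_image \<psi>)
  moreover have "hom_on act UNIV (regular s) (range (\<lambda>a. regular s a r)) \<psi>"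
    by (simp add: hom_on_def add smult range)
  ultimately show ?thesis
    unfolding isomorphic_def bij_betw_def by blast
qed

theorem proposition4p25:
  fixes scale :: "'k::field \<Rightarrow> 'a::ring_1 \<Rightarrow> 'a"
    and l0 :: "'l::order"
    and s :: side
    and act :: "'a \<Rightarrow> 'm::ab_group_add \<Rightarrow> 'm"
  assumes "k_algebra scale"
    and "shape l0"
    and "k_algebra.locally_frobenius scale l0"
    and "ring_module s act"
    and "simple_module act"
  shows "(\<exists>N. submodule (regular s) N \<and> isomorphic act UNIV (regular s) N)
           \<longleftrightarrow> coherent s act UNIV"
proof
  interpret k_algebra scale by fact
  interpret ring_module s act by fact
  {
    assume "\<exists>N. submodule (regular s) N \<and> isomorphic act UNIV (regular s) N"
    then obtain N \<phi> where \<phi>: "hom_on act UNIV (regular s) N \<phi>" "inj \<phi>"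
      unfolding isomorphic_def bij_betw_def by blast
    obtain x :: 'm where "x \<noteq> 0"
      using assms(5) unfolding simple_module_def by auto
    have "\<phi> 0 = 0" using hom_on_zero[OF \<phi>(1)] by simp
    \<comment> \<open>An injective homomorphism preserves annihilators, so that of \<open>x\<close>
      is the annihilator of an element of the ring.\<close>
    then have "act a x = 0 \<longleftrightarrow> regular s a (\<phi> x) = 0" for a
      using \<phi> unfolding hom_on_def by (metis UNIV_I injD)
    then have "finitely_generated (regular s) {a. act a x = 0}"
      using locally_frobenius_annihilator_finitely_generated[OF assms(2,3)] by simp
    with \<open>x \<noteq> 0\<close> show "coherent s act UNIV"
      using simple_module_coherent assms(4,5) by blast
  }
  {
    assume "coherent s act UNIV"
    \<comment> \<open>The module is a finitely generated submodule of itself.\<close>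
    then have "finitely_presented s act UNIV"
      unfolding coherent_def pseudo_coherent_def using submodule_UNIV by blast
    then obtain x where x: "x \<noteq> 0" "finitely_generated (regular s) {a. act a x = 0}"
      using finitely_presented_simple_annihilator assms(4,5) by blast
    have "1 \<notin> {a. act a x = 0}" using x(1) by (simp add: act_one)
    then obtain r where r: "r \<noteq> 0" "\<And>a. a \<in> {a. act a x = 0} \<Longrightarrow> regular s a r = 0"
      using locally_frobenius_proper_annihilated[OF assms(2,3) submodule_annihilator x(2)] by blast
    have "isomorphic act UNIV (regular s) (range (\<lambda>a. regular s a r))"
      using simple_module_embeds[OF assms(4,5) x(1) r(1)] r(2) by blast
    then show "\<exists>N. submodule (regular s) N \<and> isomorphic act UNIV (regular s) N"
      using ring_module.submodule_cyclic[OF ring_module_regular] by blast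
  }
qed

end
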